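(* Fix $\rho>1$ and $\theta\geqslant0$. For each horizon $n$, consider a two-armed bandit instance with gap $\Delta=\Delta_n$ satisfying $\Delta_n\sim\sqrt{\frac{\theta\log n}{n}}$ as $n\to\infty$, meaning $\Delta_n\sqrt{n/\log n}\to\sqrt\theta$. Let $R_n^\pi$ be the stochastic regret after $n$ plays, in the $n$-th instance, of the canonical UCB policy $\pi$ with exploration coefficient $\rho$. Then, as $n\to\infty$, $$\frac{R_n^\pi}{\sqrt{n\log n}}\Rightarrow\sqrt{\theta}\left(1-\lambda_\rho^\ast(\theta)\right)=:h_\rho(\theta),$$ where $\lambda^\ast_\rho(\theta)$ is the unique solution $\lambda\in(0,1)$ of $$\frac{1}{\sqrt{1-\lambda}}-\frac{1}{\sqrt{\lambda}}=\sqrt{\frac{\theta}{\rho}}.$$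
   Context: Model. There are two arms, indexed by $\{1,2\}$. Arm $i$ has a reward distribution $\mathcal{P}_i$ supported on $[0,1]$ with mean $\mu_i$; the gap is $\Delta=|\mu_1-\mu_2|$. The reward from the $j$-th pull of arm $i$ is $X_{i,j}$; the variables $(X_{i,j})_{j\geqslant1}$ are i.i.d. with law $\mathcal{P}_i$, and the two sequences are independent of each other. $N_i(t)$ denotes the number of pulls of arm $i$ up to and including time $t$. The instance $(\mathcal{P}_1,\mathcal{P}_2)$ may depend on the horizon $n$; the asymptotic statement concerns the resulting sequence of instances indexed by $n$. Canonical UCB policy with exploration coefficient $\rho$. At times $t=1,2$ play each arm once. At each time $t\geqslant3$ play an arm $$\pi_t\in\arg\max_{i\in\{1,2\}}\left(\bar X_i(t-1)+\sqrt{\frac{\rho\log(t-1)}{N_i(t-1)}}\right),\qquad \bar X_i(t-1)=\frac{\sum_{j=1}^{N_i(t-1)}X_{i,j}}{N_i(t-1)},$$ where ties in the argmax are broken by an arbitrary non-anticipating rule (based only on past observations and possibly independent randomization). Stochastic regret. With $\pi_t\in\{1,2\}$ the arm played at time $t$, $$R_n^\pi:=\sum_{t=1}^n\left[\max(\mu_1,\mu_2)-X_{\pi_t,N_{\pi_t}(t)}\right].$$ $\Rightarrow$ denotes weak convergence (here, to a constant). *)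

theory Defs
  imports "HOL-Probability.Probability"
begin

text \<open>
  The arms are the numbers 1 and 2; \<open>X i j\<close> is the reward from the \<open>j\<close>-th pull (\<open>j \<ge> 1\<close>)
  of arm \<open>i\<close>, and \<open>P i\<close> is the reward distribution of arm \<open>i\<close>. Only the values at
  \<open>i \<in> {1, 2}\<close> and \<open>j \<ge> 1\<close> are meaningful.
\<close>

locale two_armed_bandit = prob_space M
  for M :: "'a measure" +
  fixes P :: "nat \<Rightarrow> real measure"
    and X :: "nat \<Rightarrow> nat \<Rightarrow> 'a \<Rightarrow> real"
  assumes reward_law: "\<And>i. i \<in> {1, 2} \<Longrightarrow> real_distribution (P i)"
    and reward_support: "\<And>i. i \<in> {1, 2} \<Longrightarrow> AE x in P i. x \<in> {0..1}"
    and reward_distr: "\<And>i j. i \<in> {1, 2} \<Longrightarrow> 1 \<le> j \<Longrightarrow> distr M borel (X i j) = P i"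
    and reward_indep: "indep_vars (\<lambda>_. borel) (\<lambda>(i, j). X i j) ({1, 2} \<times> {1..})"

definition arm_mean :: "(nat \<Rightarrow> real measure) \<Rightarrow> nat \<Rightarrow> real" where
  "arm_mean P i = (LINT x|P i. x)"

definition gap :: "(nat \<Rightarrow> real measure) \<Rightarrow> real" where
  "gap P = \<bar>arm_mean P 1 - arm_mean P 2\<bar>"

text \<open>
  A policy is given by the arms it plays: \<open>\<pi> t \<omega>\<close> is the arm played at time \<open>t \<ge> 1\<close>.
\<close>

definition pulls :: "(nat \<Rightarrow> 'a \<Rightarrow> nat) \<Rightarrow> nat \<Rightarrow> nat \<Rightarrow> 'a \<Rightarrow> nat" where
  "pulls \<pi> i t \<omega> = card {s \<in> {1..t}. \<pi> s \<omega> = i}"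

definition obs_reward :: "(nat \<Rightarrow> nat \<Rightarrow> 'a \<Rightarrow> real) \<Rightarrow> (nat \<Rightarrow> 'a \<Rightarrow> nat) \<Rightarrow> nat \<Rightarrow> 'a \<Rightarrow> real" where
  "obs_reward X \<pi> t \<omega> = X (\<pi> t \<omega>) (pulls \<pi> (\<pi> t \<omega>) t \<omega>) \<omega>"

definition sample_mean ::
  "(nat \<Rightarrow> nat \<Rightarrow> 'a \<Rightarrow> real) \<Rightarrow> (nat \<Rightarrow> 'a \<Rightarrow> nat) \<Rightarrow> nat \<Rightarrow> nat \<Rightarrow> 'a \<Rightarrow> real" where
  "sample_mean X \<pi> i t \<omega> = (\<Sum>j = 1..pulls \<pi> i t \<omega>. X i j \<omega>) / real (pulls \<pi> i t \<omega>)"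

definition ucb_index ::
  "real \<Rightarrow> (nat \<Rightarrow> nat \<Rightarrow> 'a \<Rightarrow> real) \<Rightarrow> (nat \<Rightarrow> 'a \<Rightarrow> nat) \<Rightarrow> nat \<Rightarrow> nat \<Rightarrow> 'a \<Rightarrow> real" where
  "ucb_index \<rho> X \<pi> i t \<omega> =
     sample_mean X \<pi> i t \<omega> + sqrt (\<rho> * ln (real t) / real (pulls \<pi> i t \<omega>))"

text \<open>
  The sigma-algebra of the information available when the arm at time \<open>t\<close> is chosen: the external
  randomization \<open>U\<close> together with the arms played and the rewards observed at times
  \<open>1, \<dots>, t - 1\<close>.
\<close>

definition info_before ::
  "'a measure \<Rightarrow> (nat \<Rightarrow> nat \<Rightarrow> 'a \<Rightarrow> real) \<Rightarrow> 'u measure \<Rightarrow> ('a \<Rightarrow> 'u) \<Rightarrow> (nat \<Rightarrow> 'a \<Rightarrow> nat) \<Rightarrow>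
    nat \<Rightarrow> 'a measure" where
  "info_before M X S U \<pi> t =
     vimage_algebra (space M)
       (\<lambda>\<omega>. (U \<omega>, \<lambda>s \<in> {1..<t}. (\<pi> s \<omega>, obs_reward X \<pi> s \<omega>)))
       (S \<Otimes>\<^sub>M (\<Pi>\<^sub>M s \<in> {1..<t}. count_space {1, 2} \<Otimes>\<^sub>M borel))"

text \<open>
  \<open>U\<close>, with values in an arbitrary measurable space \<open>S\<close>, is the independent randomization used to
  break ties over the whole horizon; it may for instance be a sequence with one entry per time step.
  Since the UCB indices at time \<open>t - 1\<close> are determined by the past observations, requiring \<open>\<pi> t\<close> to be
  measurable with respect to \<open>info_before\<close> is a restriction on the tie-breaking rule (and, for
  \<open>t \<le> 2\<close>, on the order of the two initial plays) only.
\<close>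

locale canonical_ucb = two_armed_bandit M P X
  for M :: "'a measure" and P X +
  fixes S :: "'u measure"
    and U :: "'a \<Rightarrow> 'u"
    and \<rho> :: real
    and \<pi> :: "nat \<Rightarrow> 'a \<Rightarrow> nat"
  assumes randomization: "random_variable S U"
    and randomization_indep:
      "indep_set (sets (vimage_algebra (space M) U S))
         (sets (vimage_algebra (space M) (\<lambda>\<omega>. \<lambda>(i, j) \<in> {1, 2} \<times> {1..}. X i j \<omega>)
            (\<Pi>\<^sub>M _ \<in> {1, 2} \<times> {1..}. borel)))"
    and non_anticipating:
      "\<And>t. 1 \<le> t \<Longrightarrow> \<pi> t \<in> info_before M X S U \<pi> t \<rightarrow>\<^sub>M count_space {1, 2}"
    and initial_plays: "\<And>\<omega>. \<omega> \<in> space M \<Longrightarrow> {\<pi> 1 \<omega>, \<pi> 2 \<omega>} = {1, 2}"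
    and ucb_play: "\<And>t \<omega>. 3 \<le> t \<Longrightarrow> \<omega> \<in> space M \<Longrightarrow>
      is_arg_max (\<lambda>i. ucb_index \<rho> X \<pi> i (t - 1) \<omega>) (\<lambda>i. i \<in> {1, 2}) (\<pi> t \<omega>)"

definition regret ::
  "(nat \<Rightarrow> real measure) \<Rightarrow> (nat \<Rightarrow> nat \<Rightarrow> 'a \<Rightarrow> real) \<Rightarrow> (nat \<Rightarrow> 'a \<Rightarrow> nat) \<Rightarrow> nat \<Rightarrow> 'a \<Rightarrow> real" where
  "regret P X \<pi> n \<omega> =
     (\<Sum>t = 1..n. max (arm_mean P 1) (arm_mean P 2) - obs_reward X \<pi> t \<omega>)"

definition lambda_eq :: "real \<Rightarrow> real \<Rightarrow> real \<Rightarrow> bool" where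
  "lambda_eq \<rho> \<theta> l \<longleftrightarrow> 1 / sqrt (1 - l) - 1 / sqrt l = sqrt (\<theta> / \<rho>)"

definition lambda_star :: "real \<Rightarrow> real \<Rightarrow> real" where
  "lambda_star \<rho> \<theta> = (THE l. l \<in> {0<..<1} \<and> lambda_eq \<rho> \<theta> l)"

definition h_fun :: "real \<Rightarrow> real \<Rightarrow> real" where
  "h_fun \<rho> \<theta> = sqrt \<theta> * (1 - lambda_star \<rho> \<theta>)"

end

theory Submission
  imports Defs "HOL-Real_Asymp.Real_Asymp"
begin

text \<open>
  Write \<open>L = sqrt (ln n / n)\<close>. By Hoeffding's inequality, with probability tending to 1, for all
  \<open>k \<le> n\<close> the centred sum of the first \<open>k\<close> rewards of an arm is at most both \<open>sqrt (k * ln n)\<close>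
  and \<open>\<eta> * n * L\<close>. On this event everything is deterministic. If an arm has received a fraction
  \<open>x\<close> of the plays, its index in units of \<open>L\<close> is its mean plus \<open>sqrt \<rho> / sqrt x\<close>, up to an error
  \<open>min (1 / sqrt x) (\<eta> / x)\<close>; as \<open>\<rho> > 1\<close>, the error never compensates the bonus for small \<open>x\<close>
  and is negligible for the other \<open>x\<close>. Just before the last play of an arm its index is maximal, and
  this rules out that either arm exceeds the fraction at which the two limiting indices balance, which
  is the equation defining \<open>lambda_star\<close>. Since the noise contributes at most \<open>2 * \<eta> * n * L\<close>, the
  regret is the gap times the number of plays of the inferior arm up to a negligible error.
\<close>

section \<open>Concentration of the reward sums\<close>

text \<open>Indexed by the number of pulls \<open>k\<close> instead of by time: the summands are
  then independent whatever the policy does, and a bound uniform in \<open>k\<close> may be used at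
  the random pull counts.\<close>

definition noise :: "(nat \<Rightarrow> real measure) \<Rightarrow> (nat \<Rightarrow> nat \<Rightarrow> 'a \<Rightarrow> real) \<Rightarrow> nat \<Rightarrow> nat \<Rightarrow> 'a \<Rightarrow> real" where
  "noise P X i k \<omega> = (\<Sum>j = 1..k. X i j \<omega> - arm_mean P i)"

text \<open>The two bounds serve different ranges of \<open>k\<close>. Divided by \<open>k\<close>,
  the first stays a factor \<open>sqrt \<rho>\<close> below the bonus at times \<open>t\<close> with
  \<open>ln t\<close> close to \<open>ln n\<close>, even after few pulls; the second is negligible
  once \<open>k\<close> is a positive fraction of \<open>n\<close> and \<open>\<eta>\<close> is
  small.\<close>

definition concentrated ::
  "(nat \<Rightarrow> real measure) \<Rightarrow> (nat \<Rightarrow> nat \<Rightarrow> 'a \<Rightarrow> real) \<Rightarrow> real \<Rightarrow> nat \<Rightarrow> 'a \<Rightarrow> bool" where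
  "concentrated P X \<eta> n \<omega> \<longleftrightarrow> (\<forall>i \<in> {1, 2}. \<forall>k \<in> {1..n}.
     \<bar>noise P X i k \<omega>\<bar> \<le> sqrt (real k * ln (real n)) \<and>
     \<bar>noise P X i k \<omega>\<bar> \<le> \<eta> * sqrt (real n * ln (real n)))"

lemma noise_split:
  assumes "k \<le> l"
  shows "noise P X i l \<omega> = noise P X i k \<omega> + (\<Sum>j \<in> {k<..l}. X i j \<omega> - arm_mean P i)"
proof -
  have "{1..l} = {1..k} \<union> {k<..l}" using assms by auto
  then show ?thesis unfolding noise_def by (metis (no_types, lifting) finite_atLeastAtMost
        finite_greaterThanAtMost ivl_disj_int_two(8) sum.union_disjoint)
qed

lemma noise_eq_block: "noise P X i k \<omega> = (\<Sum>j \<in> {0<..k}. X i j \<omega> - arm_mean P i)"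
  using noise_split[of 0 k P X i \<omega>] by (simp add: noise_def)

section \<open>Measurability of the rewards and the probability of the concentration event\<close>

context two_armed_bandit
begin

lemma reward_measurable:
  assumes "i \<in> {1, 2}" "1 \<le> j"
  shows "X i j \<in> borel_measurable M"
proof -
  have "(i, j) \<in> {1, 2} \<times> {1..}" using assms by auto
  then show ?thesis using reward_indep unfolding indep_vars_def by fastforce
qed

lemma reward_bounded:
  assumes "i \<in> {1, 2}" "1 \<le> j"
  shows "AE \<omega> in M. X i j \<omega> \<in> {0..1}"
proof -
  have "AE x in distr M borel (X i j). x \<in> {0..1}"
    unfolding reward_distr[OF assms] by (rule reward_support[OF assms(1)])
  then show ?thesis
    by (subst (asm) AE_distr_iff) (use reward_measurable assms in auto)
qed

lemma expectation_reward:
  assumes "i \<in> {1, 2}" "1 \<le> j"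
  shows "expectation (X i j) = arm_mean P i"
  unfolding arm_mean_def reward_distr[OF assms, symmetric]
  by (rule integral_distr[symmetric]) (use reward_measurable assms in auto)

lemma block_measurable:
  assumes "i \<in> {1, 2}"
  shows "(\<lambda>\<omega>. \<Sum>j \<in> {k<..l}. X i j \<omega> - arm_mean P i) \<in> borel_measurable M"
  by (intro borel_measurable_sum borel_measurable_diff reward_measurable) (use assms in auto)

lemma block_deviation_event:
  assumes "i \<in> {1, 2}"
  shows "{\<omega> \<in> space M. \<bar>\<Sum>j \<in> {k<..l}. X i j \<omega> - arm_mean P i\<bar> \<ge> \<epsilon>} \<in> events"
  using block_measurable[OF assms, of k l] by measurable

text \<open>Hoeffding's inequality for variables of range 1, so that the denominator is the number
  of summands. The index set \<open>{i} \<times> {k<..l}\<close> keeps the pairs in which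
  \<open>reward_indep\<close> is stated.\<close>

lemma block_deviation:
  assumes "i \<in> {1, 2}" "k < l" "\<epsilon> \<ge> 0"
  shows "prob {\<omega> \<in> space M. \<bar>\<Sum>j \<in> {k<..l}. X i j \<omega> - arm_mean P i\<bar> \<ge> \<epsilon>}
           \<le> 2 * exp (- 2 * \<epsilon>\<^sup>2 / real (l - k))"
proof -
  let ?I = "{i} \<times> {k<..l}"
  interpret H: indep_interval_bounded_random_variables M ?I "\<lambda>(i, j). X i j" "\<lambda>_. 0" "\<lambda>_. 1"
  proof
    show "indep_vars (\<lambda>_. borel) (\<lambda>(i, j). X i j) ?I"
      by (rule indep_vars_subset[OF reward_indep]) (use assms in auto)
    show "AE x in M. (case p of (i, j) \<Rightarrow> X i j) x \<in> {0..1}" if "p \<in> ?I" for p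
      using that reward_bounded[of i "snd p"] assms by auto
  qed auto
  interpret H: Hoeffding_ineq M ?I "\<lambda>(i, j). X i j" "\<lambda>_. 0" "\<lambda>_. 1"
      "\<Sum>p \<in> ?I. expectation (case p of (i, j) \<Rightarrow> X i j)"
    by unfold_locales simp
  have S: "(\<Sum>p \<in> ?I. f p) = (\<Sum>j \<in> {k<..l}. f (i, j))" for f :: "nat \<times> nat \<Rightarrow> real"
    by (simp add: sum.cartesian_product')
  have mu: "(\<Sum>p \<in> ?I. expectation (case p of (i, j) \<Rightarrow> X i j)) = (\<Sum>j \<in> {k<..l}. arm_mean P i)"
    unfolding S by (intro sum.cong) (use assms expectation_reward in auto)
  show ?thesis
    using H.Hoeffding_ineq_abs_ge[OF assms(3)] assms(2) unfolding mu S
    by (simp add: sum_subtractf)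
qed

lemma concentrated_event: "{\<omega> \<in> space M. concentrated P X \<eta> n \<omega>} \<in> events"
proof -
  have *: "noise P X i k \<in> borel_measurable M" if "i \<in> {1, 2}" for i k
    using block_measurable[OF that, of 0 k] by (simp add: noise_eq_block[abs_def])
  have "Measurable.pred M (\<lambda>\<omega>. \<bar>noise P X i k \<omega>\<bar> \<le> c)" if "i \<in> {1, 2}" for i k c
    using *[OF that, of k] by measurable
  then have "Measurable.pred M (concentrated P X \<eta> n)"
    unfolding concentrated_def[abs_def]
    by (intro pred_intros_finite pred_intros_logic) auto
  then show ?thesis by simp
qed

text \<open>A bare union bound over \<open>k \<le> n\<close> loses a factor \<open>n\<close>, which \<open>\<eta> * sqrt (n * ln n)\<close> cannot
  absorb for small \<open>\<eta>\<close>. So \<open>{1..n}\<close> is cut into about \<open>8 / \<eta>\<^sup>2\<close> blocks: at the few block ends the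
  Hoeffding bound is a small power of \<open>n\<close>, and within a block the sums are so short that it is
  \<open>2 * n powr - 2\<close>.\<close>

lemma prob_not_concentrated:
  assumes "\<eta> > 0" and n: "8 \<le> \<eta>\<^sup>2 * real n"
  shows "prob {\<omega> \<in> space M. \<not> concentrated P X \<eta> n \<omega>}
           \<le> 8 / real n + 32 / \<eta>\<^sup>2 * real n powr (- (\<eta>\<^sup>2 / 2))"
proof -
  \<comment> \<open>The block length. The bound \<open>b_le\<close> makes the Hoeffding exponent
    within a block at least \<open>2 * ln n\<close>, and \<open>b_ge\<close> limits the number of
    block ends to \<open>8 / \<eta>\<^sup>2\<close>. Rounding down loses at most half because the
    rounded number is at least 2.\<close>
  define b where "b = nat \<lfloor>\<eta>\<^sup>2 * real n / 4\<rfloor>"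
  define L where "L = ln (real n)"
  define E where "E = \<eta> * sqrt (real n * L)"
  define D where "D i k l \<epsilon> = {\<omega> \<in> space M. \<bar>\<Sum>j \<in> {k<..l}. X i j \<omega> - arm_mean P i\<bar> \<ge> \<epsilon>}"
    for i k l \<epsilon>
  \<comment> \<open>\<open>N\<close> is the failure of the first bound; \<open>B\<close> and
    \<open>C\<close> share the failure of the second between the last block end before
    \<open>k\<close> and the rest of the sum up to \<open>k\<close>, with \<open>E / 2\<close> for
    each.\<close>
  define N where "N i = (\<Union>k \<in> {1..n}. D i 0 k (sqrt (real k * L)))" for i
  define B where "B i = (\<Union>m \<in> {1..n div b}. D i 0 (m * b) (E / 2))" for i
  define C where "C i = (\<Union>k \<in> {k \<in> {1..n}. k mod b \<noteq> 0}. D i (k div b * b) k (E / 2))" for i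
  have n0: "n > 0" using n by (cases n) auto
  have L0: "L \<ge> 0" using n0 by (simp add: L_def)
  have E0: "E \<ge> 0" using assms(1) L0 by (simp add: E_def)
  have b_le: "real b \<le> \<eta>\<^sup>2 * real n / 4" and b_ge: "real b \<ge> \<eta>\<^sup>2 * real n / 8" and b0: "b > 0"
    unfolding b_def using n by linarith+
  have E2: "(E / 2)\<^sup>2 = \<eta>\<^sup>2 / 4 * (real n * L)"
    using L0 by (simp add: E_def power_mult_distrib power_divide)
  have ev: "D i k l \<epsilon> \<in> events" if "i \<in> {1, 2}" for i k l \<epsilon>
    using block_deviation_event[OF that] by (simp add: D_def)
  have D_le: "prob (D i k l \<epsilon>) \<le> 2 * real n powr (- c)"
    if "i \<in> {1, 2}" "k < l" "\<epsilon> \<ge> 0" "c * L * real (l - k) \<le> 2 * \<epsilon>\<^sup>2" for i k l \<epsilon> c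
  proof -
    have "exp (- 2 * \<epsilon>\<^sup>2 / real (l - k)) \<le> exp (- c * L)"
      using that by (simp add: field_simps)
    also have "exp (- c * L) = real n powr (- c)" using n0 by (simp add: L_def powr_def)
    finally show ?thesis
      using block_deviation[OF that(1-3)] unfolding D_def by linarith
  qed
  have NB: "prob (N i) \<le> 2 / real n" if i: "i \<in> {1, 2}" for i
  proof -
    have "prob (N i) \<le> (\<Sum>k \<in> {1..n}. prob (D i 0 k (sqrt (real k * L))))"
      unfolding N_def by (rule finite_measure_subadditive_finite) (use ev i in auto)
    also have "\<dots> \<le> (\<Sum>k \<in> {1..n}. 2 * real n powr (- 2))"
      by (intro sum_mono D_le) (use i L0 in auto)
    also have "\<dots> = 2 / real n"
      using n0 by (simp add: powr_minus powr_numeral power2_eq_square field_simps)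
    finally show ?thesis .
  qed
  have BB: "prob (B i) \<le> 16 / \<eta>\<^sup>2 * real n powr (- (\<eta>\<^sup>2 / 2))" if i: "i \<in> {1, 2}" for i
  proof -
    have "prob (B i) \<le> (\<Sum>m \<in> {1..n div b}. prob (D i 0 (m * b) (E / 2)))"
      unfolding B_def by (rule finite_measure_subadditive_finite) (use ev i in auto)
    also have "\<dots> \<le> (\<Sum>m \<in> {1..n div b}. 2 * real n powr (- (\<eta>\<^sup>2 / 2)))"
    proof (intro sum_mono D_le)
      fix m assume m: "m \<in> {1..n div b}"
      have "m * b \<le> n" using m b0 by (simp add: less_eq_div_iff_mult_less_eq)
      then have "L * real (m * b) \<le> L * real n" by (intro mult_left_mono L0) linarith
      then have "\<eta>\<^sup>2 / 2 * (L * real (m * b)) \<le> \<eta>\<^sup>2 / 2 * (L * real n)"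
        by (rule mult_left_mono) simp
      then show "\<eta>\<^sup>2 / 2 * L * real (m * b - 0) \<le> 2 * (E / 2)\<^sup>2"
        unfolding E2 by (simp add: mult_ac)
    qed (use i b0 E0 in auto)
    also have "\<dots> = real (n div b) * (2 * real n powr (- (\<eta>\<^sup>2 / 2)))" by simp
    also have "\<dots> \<le> 8 / \<eta>\<^sup>2 * (2 * real n powr (- (\<eta>\<^sup>2 / 2)))"
    proof (intro mult_right_mono)
      have "real (n div b) \<le> real n / real b" by (rule of_nat_div_le_of_nat)
      also have "\<dots> \<le> 8 / \<eta>\<^sup>2" using b_ge b0 assms(1) by (simp add: field_simps)
      finally show "real (n div b) \<le> 8 / \<eta>\<^sup>2" .
    qed auto
    finally show ?thesis by simp
  qed
  have CB: "prob (C i) \<le> 2 / real n" if i: "i \<in> {1, 2}" for i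
  proof -
    have "prob (C i) \<le> (\<Sum>k \<in> {k \<in> {1..n}. k mod b \<noteq> 0}. prob (D i (k div b * b) k (E / 2)))"
      unfolding C_def by (rule finite_measure_subadditive_finite) (use ev i in auto)
    also have "\<dots> \<le> (\<Sum>k \<in> {k \<in> {1..n}. k mod b \<noteq> 0}. 2 * real n powr (- 2))"
    proof (intro sum_mono D_le)
      fix k assume k: "k \<in> {k \<in> {1..n}. k mod b \<noteq> 0}"
      have kk: "k = k div b * b + k mod b" by simp
      show "k div b * b < k"
        using k kk by (metis (mono_tags, lifting) mem_Collect_eq less_add_same_cancel1 neq0_conv)
      have "k - k div b * b = k mod b" by (simp add: minus_div_mult_eq_mod)
      moreover have "k mod b < b" using b0 by simp
      ultimately have "real (k - k div b * b) \<le> \<eta>\<^sup>2 * real n / 4" using b_le by linarith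
      then have "2 * L * real (k - k div b * b) \<le> 2 * L * (\<eta>\<^sup>2 * real n / 4)"
        using L0 by (intro mult_left_mono) auto
      then show "2 * L * real (k - k div b * b) \<le> 2 * (E / 2)\<^sup>2" unfolding E2 by (simp add: mult_ac)
    qed (use i E0 in auto)
    also have "\<dots> \<le> (\<Sum>k \<in> {1..n}. 2 * real n powr (- 2))"
      by (intro sum_mono2) auto
    also have "\<dots> = 2 / real n"
      using n0 by (simp add: powr_minus powr_numeral power2_eq_square field_simps)
    finally show ?thesis .
  qed
  have ev': "N i \<in> events" "B i \<in> events" "C i \<in> events" if "i \<in> {1, 2}" for i
    unfolding N_def B_def C_def using ev that by (auto intro!: sets.finite_UN)
  have sub: "{\<omega> \<in> space M. \<not> concentrated P X \<eta> n \<omega>} \<subseteq> (\<Union>i \<in> {1, 2}. N i \<union> (B i \<union> C i))"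
  proof
    fix \<omega> assume w: "\<omega> \<in> {\<omega> \<in> space M. \<not> concentrated P X \<eta> n \<omega>}"
    then obtain i k where ik: "i \<in> {1, 2}" "k \<in> {1..n}"
      and "sqrt (real k * L) < \<bar>noise P X i k \<omega>\<bar> \<or> E < \<bar>noise P X i k \<omega>\<bar>"
      unfolding concentrated_def E_def L_def by force
    then consider "sqrt (real k * L) < \<bar>noise P X i k \<omega>\<bar>" | "E < \<bar>noise P X i k \<omega>\<bar>" by blast
    then show "\<omega> \<in> (\<Union>i \<in> {1, 2}. N i \<union> (B i \<union> C i))"
    proof cases
      case 1
      then have "\<omega> \<in> N i" using w ik by (force simp: N_def D_def noise_eq_block)
      then show ?thesis using ik by blast
    next
      case 2
      have le: "k div b * b \<le> k" by simp
      let ?S = "\<Sum>j \<in> {k div b * b<..k}. X i j \<omega> - arm_mean P i"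
      \<comment> \<open>The sum is split at the last block end, so one of the two pieces exceeds
        \<open>E / 2\<close>. That piece cannot be an empty sum, which gives the side conditions in
        \<open>B\<close> and \<open>C\<close>.\<close>
      have "E < \<bar>noise P X i (k div b * b) \<omega> + ?S\<bar>"
        using 2 noise_split[OF le, of P X i \<omega>] by simp
      then consider "E / 2 < \<bar>noise P X i (k div b * b) \<omega>\<bar>" | "E / 2 < \<bar>?S\<bar>" by linarith
      then show ?thesis
      proof cases
        case 1
        have "k div b \<noteq> 0"
        proof
          assume "k div b = 0"
          with 1 show False using E0 by (simp add: noise_def)
        qed
        moreover have "k div b \<le> n div b" using ik by (simp add: div_le_mono)
        ultimately have "\<omega> \<in> B i" using w 1
          by (auto simp: B_def D_def noise_eq_block intro!: bexI[of _ "k div b"])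
        then show ?thesis using ik by blast
      next
        case 2
        have "k mod b \<noteq> 0"
        proof
          assume "k mod b = 0"
          then have "k div b * b = k" by auto
          with 2 show False using E0 by simp
        qed
        then have "\<omega> \<in> C i" using w ik 2
          by (auto simp: C_def D_def intro!: exI[of _ k])
        then show ?thesis using ik by blast
      qed
    qed
  qed
  have "prob {\<omega> \<in> space M. \<not> concentrated P X \<eta> n \<omega>} \<le> prob (\<Union>i \<in> {1, 2}. N i \<union> (B i \<union> C i))"
    by (rule finite_measure_mono[OF sub]) (use ev' in auto)
  also have "\<dots> \<le> (\<Sum>i \<in> {1, 2}. prob (N i \<union> (B i \<union> C i)))"
    by (rule finite_measure_subadditive_finite) (use ev' in auto)
  also have "\<dots> \<le> (\<Sum>i \<in> {1, 2::nat}. 2 / real n + (16 / \<eta>\<^sup>2 * real n powr (- (\<eta>\<^sup>2 / 2)) + 2 / real n))"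
  proof (intro sum_mono)
    fix i :: nat assume i: "i \<in> {1, 2}"
    have "prob (N i \<union> (B i \<union> C i)) \<le> prob (N i) + prob (B i \<union> C i)"
      by (rule measure_Un_le) (use ev' i in auto)
    moreover have "prob (B i \<union> C i) \<le> prob (B i) + prob (C i)"
      by (rule measure_Un_le) (use ev' i in auto)
    ultimately show "prob (N i \<union> (B i \<union> C i))
        \<le> 2 / real n + (16 / \<eta>\<^sup>2 * real n powr (- (\<eta>\<^sup>2 / 2)) + 2 / real n)"
      using NB[OF i] BB[OF i] CB[OF i] by linarith
  qed
  also have "\<dots> = 8 / real n + 32 / \<eta>\<^sup>2 * real n powr (- (\<eta>\<^sup>2 / 2))"
    by simp
  finally show ?thesis .
qed

end

section \<open>Balance of the limiting indices\<close>

text \<open>The left-hand side \<open>\<phi>\<close> of the equation is strictly increasing on the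
  open unit interval, which gives uniqueness; it vanishes at \<open>1 / 2\<close> and reaches every
  \<open>c \<ge> 0\<close>, so a solution exists by the intermediate value theorem.\<close>

lemma lambda_unique:
  fixes \<rho> \<theta> :: real
  assumes "\<rho> > 0" "\<theta> \<ge> 0"
  shows "\<exists>!l. l \<in> {0<..<1} \<and> lambda_eq \<rho> \<theta> l"
proof -
  define c where "c = sqrt (\<theta> / \<rho>)"
  define \<phi> where "\<phi> l = 1 / sqrt (1 - l) - 1 / sqrt l" for l :: real
  have c0: "c \<ge> 0" using assms by (simp add: c_def)
  have mono: "\<phi> l < \<phi> m" if "0 < l" "l < m" "m < 1" for l m
  proof -
    have "1 / sqrt (1 - l) < 1 / sqrt (1 - m)" "1 / sqrt m < 1 / sqrt l"
      using that by (intro divide_strict_left_mono; simp)+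
    then show ?thesis by (simp add: \<phi>_def)
  qed
  \<comment> \<open>Chosen so that \<open>1 / sqrt (1 - u) = c + 2\<close>; as
    \<open>u \<ge> 3 / 4\<close>, the subtracted term is at most 2 and
    \<open>\<phi> u \<ge> c\<close>.\<close>
  define u where "u = 1 - 1 / (c + 2)\<^sup>2"
  have "1 / (c + 2)\<^sup>2 \<le> 1 / 2\<^sup>2" using c0 by (intro divide_left_mono power_mono) auto
  then have u: "3 / 4 \<le> u" "u < 1" using c0 by (auto simp: u_def)
  have "sqrt (1 - u) = 1 / (c + 2)"
    using c0 by (simp add: u_def real_sqrt_divide)
  moreover have "1 / 2 \<le> sqrt u" using u by (intro real_le_rsqrt) (auto simp: power2_eq_square)
  then have "1 / sqrt u \<le> 2" using u by (simp add: field_simps)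
  ultimately have cu: "c \<le> \<phi> u" by (simp add: \<phi>_def)
  have "\<exists>l\<ge>1 / 2. l \<le> u \<and> \<phi> l = c"
  proof (rule IVT')
    show "\<phi> (1 / 2) \<le> c" using c0 by (simp add: \<phi>_def)
    show "continuous_on {1 / 2..u} \<phi>"
      unfolding \<phi>_def using u by (intro continuous_intros) auto
  qed (use cu u in auto)
  then obtain l where l: "1 / 2 \<le> l" "l \<le> u" "\<phi> l = c" by blast
  show ?thesis
  proof (rule ex1I[of _ l])
    show "l \<in> {0<..<1} \<and> lambda_eq \<rho> \<theta> l"
      using l u by (auto simp: lambda_eq_def \<phi>_def c_def)
    fix m assume "m \<in> {0<..<1} \<and> lambda_eq \<rho> \<theta> m"
    then have "0 < m" "m < 1" "\<phi> m = \<phi> l" using l by (auto simp: lambda_eq_def \<phi>_def c_def)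
    then show "m = l" using mono[of l m] mono[of m l] l u by (cases l m rule: linorder_cases) auto
  qed
qed

text \<open>Here \<open>d\<close> is the difference of the two means in units of \<open>sqrt (ln n / n)\<close>, and \<open>r\<close> the ratio
  \<open>ln t / ln n\<close> at the time \<open>t\<close> at which the indices are compared.\<close>

lemma index_separation:
  fixes \<rho> a \<xi> D :: real
  assumes "\<rho> > 1" "0 < a" "0 < \<xi>" "a + \<xi> < 1"
    and balance: "D + sqrt \<rho> / sqrt a = sqrt \<rho> / sqrt (1 - a)"
  shows "\<forall>\<^sub>F \<eta> in at_right 0. \<forall>x y d r. 0 < x \<longrightarrow> x \<le> 1 - a - \<xi> \<longrightarrow> a + \<xi> \<le> y \<longrightarrow> \<bar>d - D\<bar> \<le> \<eta> \<longrightarrow>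
           1 - \<eta> \<le> r \<longrightarrow> d + sqrt \<rho> / sqrt y + \<eta> / y < sqrt (\<rho> * r) / sqrt x - min (1 / sqrt x) (\<eta> / x)"
proof -
  define B where "B = sqrt \<rho> / sqrt (1 - a)"
  define C where "C = sqrt \<rho> / sqrt (1 - a - \<xi>)"
  \<comment> \<open>The threshold between the two noise bounds: up to \<open>x0\<close>, even the
    larger noise \<open>1 / sqrt x\<close> leaves the bonus at least \<open>B + 1\<close> (for
    \<open>r = 1\<close>); beyond \<open>x0\<close>, the noise \<open>\<eta> / x\<close> is at most
    \<open>\<eta> / x0\<close>.\<close>
  define x0 where "x0 = ((sqrt \<rho> - 1) / (B + 1))\<^sup>2"
  have s1: "sqrt \<rho> > 1" using assms by simp
  have B0: "B > 0" using assms by (simp add: B_def)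
  have BC: "B < C" unfolding B_def C_def
    using assms by (intro divide_strict_left_mono) auto
  have x0: "x0 > 0" "sqrt x0 = (sqrt \<rho> - 1) / (B + 1)" using s1 B0 by (auto simp: x0_def)
  have x0B: "(sqrt \<rho> - 1) / sqrt x0 = B + 1" using s1 B0 by (simp add: x0)
  \<comment> \<open>The margins by which the claim holds in the worst case over \<open>x\<close>,
    \<open>y\<close>, \<open>d\<close> and \<open>r\<close>, one for each side of \<open>x0\<close>.
    They are continuous in \<open>\<eta>\<close>, with the positive limits \<open>1\<close> and
    \<open>C - B\<close>.\<close>
  have t1: "((\<lambda>\<eta>. (sqrt (\<rho> * (1 - \<eta>)) - 1) / sqrt x0 - (B + \<eta> * (1 + 1 / a)))
      \<longlongrightarrow> (sqrt (\<rho> * (1 - 0)) - 1) / sqrt x0 - (B + 0 * (1 + 1 / a))) (at_right 0)"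
    by (intro tendsto_intros) (use x0 in auto)
  have t2: "((\<lambda>\<eta>. sqrt (\<rho> * (1 - \<eta>)) / sqrt (1 - a - \<xi>) - \<eta> / x0 - (B + \<eta> * (1 + 1 / a)))
      \<longlongrightarrow> sqrt (\<rho> * (1 - 0)) / sqrt (1 - a - \<xi>) - 0 / x0 - (B + 0 * (1 + 1 / a))) (at_right 0)"
    by (intro tendsto_intros) (use x0 assms in auto)
  have t3: "((\<lambda>\<eta>. sqrt (\<rho> * (1 - \<eta>))) \<longlongrightarrow> sqrt (\<rho> * (1 - 0))) (at_right 0)"
    by (intro tendsto_intros)
  have e1: "\<forall>\<^sub>F \<eta> in at_right 0. 0 < (sqrt (\<rho> * (1 - \<eta>)) - 1) / sqrt x0 - (B + \<eta> * (1 + 1 / a))"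
    by (rule order_tendstoD(1)[OF t1]) (use x0B in simp)
  have e2: "\<forall>\<^sub>F \<eta> in at_right 0.
      0 < sqrt (\<rho> * (1 - \<eta>)) / sqrt (1 - a - \<xi>) - \<eta> / x0 - (B + \<eta> * (1 + 1 / a))"
    by (rule order_tendstoD(1)[OF t2]) (use BC in \<open>simp add: C_def\<close>)
  have e3: "\<forall>\<^sub>F \<eta> in at_right 0. 1 < sqrt (\<rho> * (1 - \<eta>))"
    by (rule order_tendstoD(1)[OF t3]) (use s1 in simp)
  have e4: "\<forall>\<^sub>F \<eta> in at_right 0. (0::real) < \<eta>" by (rule eventually_at_right_less)
  show ?thesis
    using e1 e2 e3 e4
  proof (eventually_elim, intro allI impI)
    fix \<eta> x y d r :: real
    assume h: "0 < (sqrt (\<rho> * (1 - \<eta>)) - 1) / sqrt x0 - (B + \<eta> * (1 + 1 / a))"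
      "0 < sqrt (\<rho> * (1 - \<eta>)) / sqrt (1 - a - \<xi>) - \<eta> / x0 - (B + \<eta> * (1 + 1 / a))"
      "1 < sqrt (\<rho> * (1 - \<eta>))" "0 < \<eta>"
      and x: "0 < x" "x \<le> 1 - a - \<xi>" and y: "a + \<xi> \<le> y" and d: "\<bar>d - D\<bar> \<le> \<eta>" and r: "1 - \<eta> \<le> r"
    \<comment> \<open>The left-hand side decreases in \<open>y\<close>, so it is largest at the
      smallest \<open>y\<close>. Going down to \<open>a\<close> itself makes \<open>balance\<close>
      applicable; the gap \<open>\<xi>\<close> is still exploited on the side of
      \<open>x\<close>.\<close>
    have "sqrt \<rho> / sqrt y \<le> sqrt \<rho> / sqrt a" "\<eta> / y \<le> \<eta> / a"
      using assms y h by (intro divide_left_mono; simp)+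
    moreover have "B + \<eta> * (1 + 1 / a) = D + \<eta> + sqrt \<rho> / sqrt a + \<eta> / a"
      using balance by (simp add: B_def algebra_simps)
    ultimately have lhs: "d + sqrt \<rho> / sqrt y + \<eta> / y \<le> B + \<eta> * (1 + 1 / a)" using d by linarith
    have sr: "sqrt (\<rho> * (1 - \<eta>)) \<le> sqrt (\<rho> * r)" using r assms by simp
    show "d + sqrt \<rho> / sqrt y + \<eta> / y < sqrt (\<rho> * r) / sqrt x - min (1 / sqrt x) (\<eta> / x)"
    proof (cases "x \<le> x0")
      case True
      \<comment> \<open>Monotonicity in \<open>x\<close> needs a nonnegative numerator; this is the
        place where \<open>\<rho> > 1\<close> enters, through \<open>e3\<close>.\<close>
      have "(sqrt (\<rho> * (1 - \<eta>)) - 1) / sqrt x0 \<le> (sqrt (\<rho> * (1 - \<eta>)) - 1) / sqrt x"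
        using True x x0(1) h by (intro divide_left_mono) auto
      also have "\<dots> \<le> (sqrt (\<rho> * r) - 1) / sqrt x" using sr x by (intro divide_right_mono) auto
      also have "\<dots> = sqrt (\<rho> * r) / sqrt x - 1 / sqrt x" by (simp add: diff_divide_distrib)
      also have "\<dots> \<le> sqrt (\<rho> * r) / sqrt x - min (1 / sqrt x) (\<eta> / x)" by simp
      finally show ?thesis using lhs h by linarith
    next
      case False
      have "sqrt (\<rho> * (1 - \<eta>)) / sqrt (1 - a - \<xi>) \<le> sqrt (\<rho> * r) / sqrt x"
        using sr x h by (intro frac_le) auto
      moreover have "\<eta> / x \<le> \<eta> / x0" using False x x0(1) h by (intro divide_left_mono) auto
      ultimately show ?thesis using lhs h by linarith
    qed
  qed
qed

text \<open>Convergence in probability to a constant suffices, also when the probability space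
  changes with \<open>n\<close>: the limiting cdf is a step at \<open>c\<close>, and on either side
  of \<open>c\<close> the cdfs differ from it by at most a deviation probability.\<close>

lemma weak_conv_m_return:
  fixes M :: "nat \<Rightarrow> 'a measure" and Y :: "nat \<Rightarrow> 'a \<Rightarrow> real" and c :: real
  assumes ps: "\<And>n. prob_space (M n)"
    and meas: "\<And>n. Y n \<in> borel_measurable (M n)"
    and conv: "\<And>e. e > 0 \<Longrightarrow> (\<lambda>n. measure (M n) {\<omega> \<in> space (M n). \<bar>Y n \<omega> - c\<bar> > e}) \<longlonglongrightarrow> 0"
  shows "weak_conv_m (\<lambda>n. distr (M n) borel (Y n)) (return borel c)"
  unfolding weak_conv_m_def weak_conv_def
proof (intro allI impI)
  fix x assume cont: "isCont (cdf (return borel c)) x"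
  have cdf_ret: "cdf (return borel c) = (\<lambda>x. if c \<le> x then 1 else 0)"
    by (auto simp: cdf_def measure_return fun_eq_iff)
  have cdf_Y: "cdf (distr (M n) borel (Y n)) x = measure (M n) {\<omega> \<in> space (M n). Y n \<omega> \<le> x}" for n x
    unfolding cdf_def using meas[of n]
    by (subst measure_distr) (auto intro!: arg_cong[where f = "measure (M n)"])
  have [measurable]: "Y n \<in> borel_measurable (M n)" for n by (rule meas)
  consider "x < c" | "x = c" | "c < x" by linarith
  then show "(\<lambda>n. cdf (distr (M n) borel (Y n)) x) \<longlonglongrightarrow> cdf (return borel c) x"
  proof cases
    case 1
    have "(\<lambda>n. cdf (distr (M n) borel (Y n)) x) \<longlonglongrightarrow> 0"
    \<comment> \<open>The deviation \<open>c - x\<close> may be attained exactly; halving it yields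
      the strict inequality in \<open>conv\<close>.\<close>
    proof (rule tendsto_sandwich[OF _ _ tendsto_const conv[of "(c - x) / 2"]])
      show "\<forall>\<^sub>F n in sequentially. cdf (distr (M n) borel (Y n)) x
          \<le> measure (M n) {\<omega> \<in> space (M n). (c - x) / 2 < \<bar>Y n \<omega> - c\<bar>}"
      proof (intro always_eventually allI)
        fix n
        interpret prob_space "M n" by (rule ps)
        show "cdf (distr (M n) borel (Y n)) x
          \<le> measure (M n) {\<omega> \<in> space (M n). (c - x) / 2 < \<bar>Y n \<omega> - c\<bar>}"
          unfolding cdf_Y using 1 by (intro finite_measure_mono) auto
      qed
    qed (use 1 in \<open>auto simp: cdf_Y\<close>)
    then show ?thesis using 1 by (simp add: cdf_ret)
  next
    case 2
    \<comment> \<open>The step function jumps at \<open>c\<close>, so \<open>c\<close> is not a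
      continuity point: continuity would force the left limit 0 to equal 1.\<close>
    have "((\<lambda>x. if c \<le> x then 1 else (0::real)) \<longlongrightarrow> 1) (at_left c)"
      using cont 2 unfolding cdf_ret isCont_def by (simp add: filterlim_at_split)
    moreover have "((\<lambda>x. if c \<le> x then 1 else (0::real)) \<longlongrightarrow> 0) (at_left c)"
      by (rule tendsto_eventually) (auto simp: eventually_at_left_field intro: exI[of _ "c - 1"])
    ultimately have "(1::real) = 0" by (intro tendsto_unique[OF trivial_limit_at_left_real])
    then show ?thesis by simp
  next
    case 3
    have "(\<lambda>n. cdf (distr (M n) borel (Y n)) x) \<longlonglongrightarrow> 1"
    proof (rule tendsto_sandwich[OF _ _ _ tendsto_const])
      show "(\<lambda>n. 1 - measure (M n) {\<omega> \<in> space (M n). \<bar>Y n \<omega> - c\<bar> > x - c}) \<longlonglongrightarrow> 1"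
        using tendsto_diff[OF tendsto_const[of 1] conv[of "x - c"]] 3 by simp
      show "\<forall>\<^sub>F n in sequentially. 1 - measure (M n) {\<omega> \<in> space (M n). \<bar>Y n \<omega> - c\<bar> > x - c}
          \<le> cdf (distr (M n) borel (Y n)) x"
      proof (intro always_eventually allI)
        fix n
        interpret prob_space "M n" by (rule ps)
        have "1 - prob {\<omega> \<in> space (M n). \<bar>Y n \<omega> - c\<bar> > x - c}
            = prob (space (M n) - {\<omega> \<in> space (M n). \<bar>Y n \<omega> - c\<bar> > x - c})"
          by (rule prob_compl[symmetric]) measurable
        also have "\<dots> \<le> prob {\<omega> \<in> space (M n). Y n \<omega> \<le> x}"
          by (intro finite_measure_mono) auto
        finally show "1 - prob {\<omega> \<in> space (M n). \<bar>Y n \<omega> - c\<bar> > x - c}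
            \<le> cdf (distr (M n) borel (Y n)) x" by (simp add: cdf_Y)
      qed
      show "\<forall>\<^sub>F n in sequentially. cdf (distr (M n) borel (Y n)) x \<le> 1"
      proof (intro always_eventually allI)
        fix n
        interpret prob_space "M n" by (rule ps)
        show "cdf (distr (M n) borel (Y n)) x \<le> 1" by (simp add: cdf_Y)
      qed
    qed
    then show ?thesis using 3 by (simp add: cdf_ret)
  qed
qed

section \<open>Pull counts and regret on the concentration event\<close>

lemma pulls_0 [simp]: "pulls \<pi> i 0 \<omega> = 0"
  by (simp add: pulls_def)

lemma pulls_Suc: "pulls \<pi> i (Suc t) \<omega> = pulls \<pi> i t \<omega> + (if \<pi> (Suc t) \<omega> = i then 1 else 0)"
proof -
  have "{s \<in> {1..Suc t}. \<pi> s \<omega> = i}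
      = (if \<pi> (Suc t) \<omega> = i then insert (Suc t) {s \<in> {1..t}. \<pi> s \<omega> = i} else {s \<in> {1..t}. \<pi> s \<omega> = i})"
    by (auto simp: le_Suc_eq)
  then show ?thesis by (simp add: pulls_def)
qed

lemma pulls_eq_sum: "real (pulls \<pi> i t \<omega>) = (\<Sum>s = 1..t. if \<pi> s \<omega> = i then 1 else 0)"
  by (induction t) (auto simp: pulls_Suc)

lemma pulls_mono: "s \<le> t \<Longrightarrow> pulls \<pi> i s \<omega> \<le> pulls \<pi> i t \<omega>"
  by (induction t) (auto simp: pulls_Suc le_Suc_eq)

lemma pulls_le: "pulls \<pi> i t \<omega> \<le> t"
  by (induction t) (auto simp: pulls_Suc)

text \<open>Leads from the final count of an arm to a time at which that arm was chosen, and hence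
  had the maximal index, while its count was only one short of the final one.\<close>

lemma pulls_last_play:
  assumes "pulls \<pi> i n \<omega> > 0"
  obtains s where "Suc s \<le> n" "\<pi> (Suc s) \<omega> = i" "pulls \<pi> i n \<omega> = Suc (pulls \<pi> i s \<omega>)"
  using assms
proof (induction n arbitrary: thesis)
  case (Suc n)
  show ?case
  proof (cases "\<pi> (Suc n) \<omega> = i")
    case True
    then show ?thesis using Suc.prems(1)[of n] by (simp add: pulls_Suc)
  next
    case False
    then have "pulls \<pi> i n \<omega> > 0" "pulls \<pi> i (Suc n) \<omega> = pulls \<pi> i n \<omega>"
      using Suc.prems by (auto simp: pulls_Suc)
    then show ?thesis using Suc.IH Suc.prems(1) by (metis le_Suc_eq)
  qed
qed simp

text \<open>A pathwise identity: each play appends to the partial sum of the arm played exactly its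
  next reward.\<close>

lemma sum_obs_reward:
  assumes "\<And>t. 1 \<le> t \<Longrightarrow> \<pi> t \<omega> \<in> {1, 2}"
  shows "(\<Sum>t = 1..n. obs_reward X \<pi> t \<omega>)
    = (\<Sum>j = 1..pulls \<pi> 1 n \<omega>. X 1 j \<omega>) + (\<Sum>j = 1..pulls \<pi> 2 n \<omega>. X 2 j \<omega>)"
proof (induction n)
  case (Suc n)
  have "\<pi> (Suc n) \<omega> = 1 \<or> \<pi> (Suc n) \<omega> = 2" using assms[of "Suc n"] by auto
  then show ?case using Suc by (auto simp: obs_reward_def pulls_Suc)
qed simp

lemma sum_rewards: "(\<Sum>j = 1..k. X i j \<omega>) = noise P X i k \<omega> + real k * arm_mean P i"
  by (simp add: noise_def sum_subtractf)

section \<open>Measurability and pull counts of the policy\<close>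

context canonical_ucb
begin

lemma play_range:
  assumes "1 \<le> t" "\<omega> \<in> space M"
  shows "\<pi> t \<omega> \<in> {1, 2}"
  using measurable_space[OF non_anticipating[OF assms(1)], of \<omega>] assms(2)
  by (simp add: info_before_def)

text \<open>By strong induction: \<open>info_before\<close> is generated by \<open>U\<close> and the
  earlier plays and rewards, which are measurable, so its sets are events of \<open>M\<close> and
  \<open>\<pi> t\<close> is measurable as well. The reward at time \<open>t\<close> then
  follows.\<close>

lemma play_obs_measurable:
  assumes "1 \<le> t"
  shows "\<pi> t \<in> M \<rightarrow>\<^sub>M count_space {1, 2} \<and> obs_reward X \<pi> t \<in> borel_measurable M"
  using assms
proof (induction t rule: less_induct)
  case (less t)
  define F where "F = (\<lambda>\<omega>. (U \<omega>, \<lambda>s \<in> {1..<t}. (\<pi> s \<omega>, obs_reward X \<pi> s \<omega>)))"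
  let ?N = "S \<Otimes>\<^sub>M (\<Pi>\<^sub>M s \<in> {1..<t}. count_space {1, 2::nat} \<Otimes>\<^sub>M (borel :: real measure))"
  have "F \<in> M \<rightarrow>\<^sub>M ?N"
    unfolding F_def using randomization less.IH
    by (intro measurable_Pair measurable_restrict) auto
  then have "(\<lambda>\<omega>. \<omega>) \<in> M \<rightarrow>\<^sub>M vimage_algebra (space M) F ?N"
    by (intro measurable_vimage_algebra2) auto
  from measurable_compose[OF this] non_anticipating[OF less.prems]
  have play: "\<pi> t \<in> M \<rightarrow>\<^sub>M count_space {1, 2}"
    unfolding info_before_def F_def by blast
  have play': "\<pi> s \<in> M \<rightarrow>\<^sub>M count_space {1, 2}" if "s \<in> {1..t}" for s
    using that less.IH[of s] play by (cases "s = t") auto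
  have pl: "Measurable.pred M (\<lambda>\<omega>. \<pi> s \<omega> = i)" if "s \<in> {1..t}" for s i
    by (rule measurable_compose[OF play'[OF that]]) simp
  have "(\<lambda>\<omega>. real (pulls \<pi> i t \<omega>)) \<in> borel_measurable M" for i
    unfolding pulls_eq_sum by (intro borel_measurable_sum measurable_If) (use pl in auto)
  then have "Measurable.pred M (\<lambda>\<omega>. real (pulls \<pi> i t \<omega>) = real k)" for i k
    by measurable
  then have pu: "Measurable.pred M (\<lambda>\<omega>. pulls \<pi> i t \<omega> = k)" for i k by simp
  have ev: "{\<omega> \<in> space M. \<pi> t \<omega> = i \<and> pulls \<pi> i t \<omega> = k} \<in> events" for i k
    using pred_intros_logic(3)[OF pl pu] less.prems by (auto simp: pred_def)
  \<comment> \<open>The arm and the pull number of the reward are random; this finite sum runs over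
    their possible values. The pull number is at least 1 because the play at time \<open>t\<close>
    is already counted.\<close>
  have "(\<lambda>\<omega>. \<Sum>i \<in> {1, 2}. \<Sum>k \<in> {1..t}.
      if \<pi> t \<omega> = i \<and> pulls \<pi> i t \<omega> = k then X i k \<omega> else 0) \<in> borel_measurable M"
    by (intro borel_measurable_sum measurable_If reward_measurable measurable_const ev) auto
  also have "?this \<longleftrightarrow> obs_reward X \<pi> t \<in> borel_measurable M"
  proof (rule measurable_cong)
    fix \<omega> assume w: "\<omega> \<in> space M"
    obtain t' where t': "t = Suc t'" using less.prems by (cases t) auto
    have "pulls \<pi> (\<pi> t \<omega>) t \<omega> \<in> {1..t}"
      using pulls_le[of \<pi> "\<pi> t \<omega>" t \<omega>] by (simp add: t' pulls_Suc)
    then have "(\<Sum>k \<in> {1..t}. if \<pi> t \<omega> = i \<and> pulls \<pi> i t \<omega> = k then X i k \<omega> else 0)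
        = (if \<pi> t \<omega> = i then obs_reward X \<pi> t \<omega> else 0)" for i
      by (auto simp: obs_reward_def)
    then show "(\<Sum>i \<in> {1, 2}. \<Sum>k \<in> {1..t}. if \<pi> t \<omega> = i \<and> pulls \<pi> i t \<omega> = k then X i k \<omega> else 0)
        = obs_reward X \<pi> t \<omega>"
      using play_range[OF less.prems w] by auto
  qed
  finally show ?case using play by blast
qed

lemma regret_measurable: "regret P X \<pi> n \<in> borel_measurable M"
  unfolding regret_def[abs_def]
  by (intro borel_measurable_sum borel_measurable_diff) (use play_obs_measurable in auto)

lemma pulls_add:
  assumes "\<omega> \<in> space M" "{i, j} = {1, 2}"
  shows "pulls \<pi> i t \<omega> + pulls \<pi> j t \<omega> = t"
proof (induction t)
  case (Suc t)
  have "\<pi> (Suc t) \<omega> \<in> {i, j}" "i \<noteq> j" using play_range[of "Suc t" \<omega>] assms by auto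
  then show ?case using Suc by (auto simp: pulls_Suc)
qed simp

lemma pulls_pos:
  assumes "\<omega> \<in> space M" "i \<in> {1, 2}" "2 \<le> t"
  shows "0 < pulls \<pi> i t \<omega>"
proof -
  have "i \<in> {\<pi> 1 \<omega>, \<pi> 2 \<omega>}" using initial_plays[OF assms(1)] assms(2) by simp
  then have "pulls \<pi> i 2 \<omega> > 0" by (auto simp: pulls_Suc numeral_2_eq_2)
  then show ?thesis using pulls_mono[OF assms(3), of \<pi> i \<omega>] by linarith
qed

text \<open>On average only plays of the inferior arm \<open>w\<close> cost anything. The
  fluctuations of the rewards are confined to two noise terms at random counts, to which the uniform
  bounds of \<open>concentrated\<close> apply.\<close>

lemma regret_decomposition:
  assumes "\<omega> \<in> space M" "{w, b} = {1, 2}" "arm_mean P w \<le> arm_mean P b"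
  shows "regret P X \<pi> n \<omega> = gap P * real (pulls \<pi> w n \<omega>)
    - noise P X w (pulls \<pi> w n \<omega>) \<omega> - noise P X b (pulls \<pi> b n \<omega>) \<omega>"
proof -
  have wb: "w = 1 \<and> b = 2 \<or> w = 2 \<and> b = 1" using assms(2) by (auto simp: doubleton_eq_iff)
  have n: "real n = real (pulls \<pi> w n \<omega>) + real (pulls \<pi> b n \<omega>)"
    using pulls_add[OF assms(1,2), of n] by linarith
  have "regret P X \<pi> n \<omega> = real n * arm_mean P b - (\<Sum>t = 1..n. obs_reward X \<pi> t \<omega>)"
    using wb assms(3) by (auto simp: regret_def sum_subtractf max_def)
  moreover have "(\<Sum>t = 1..n. obs_reward X \<pi> t \<omega>)
      = noise P X w (pulls \<pi> w n \<omega>) \<omega> + real (pulls \<pi> w n \<omega>) * arm_mean P w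
      + (noise P X b (pulls \<pi> b n \<omega>) \<omega> + real (pulls \<pi> b n \<omega>) * arm_mean P b)"
    using wb sum_obs_reward[of \<pi> \<omega> X n] play_range[OF _ assms(1)]
    unfolding sum_rewards[where P = P] by auto
  moreover have "gap P = arm_mean P b - arm_mean P w"
    using wb assms(3) by (auto simp: gap_def)
  ultimately show ?thesis by (simp only: n) (simp add: algebra_simps)
qed

text \<open>Compare the indices just before the last play of \<open>i\<close>: with \<open>x\<close> and \<open>y\<close> the fractions of
  the plays given to \<open>j\<close> and \<open>i\<close>, the two sides of \<open>separated\<close> bound them in units of
  \<open>sqrt (ln n / n)\<close>.\<close>

lemma pulls_upper_bound:
  fixes n :: nat and a \<xi> \<eta> :: real
  defines "L \<equiv> sqrt (ln (real n) / real n)"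
  assumes \<omega>: "\<omega> \<in> space M" and ij: "{i, j} = {1, 2}"
    and conc: "concentrated P X \<eta> n \<omega>"
    and pos: "\<rho> > 0" "a > 0" "\<xi> > 0" "\<eta> > 0" and n: "a * real n \<ge> 2" "n \<ge> 2"
    and separated: "\<And>x y. 0 < x \<Longrightarrow> x \<le> 1 - a - \<xi> \<Longrightarrow> a + \<xi> \<le> y \<Longrightarrow>
      (arm_mean P i - arm_mean P j) / L + sqrt \<rho> / sqrt y + \<eta> / y
        < sqrt (\<rho> * (ln (a * real n) / ln (real n))) / sqrt x - min (1 / sqrt x) (\<eta> / x)"
  shows "real (pulls \<pi> i n \<omega>) \<le> (a + \<xi>) * real n + 1"
proof (rule ccontr)
  assume "\<not> ?thesis"
  then have big: "real (pulls \<pi> i n \<omega>) > (a + \<xi>) * real n + 1" by simp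
  have axn: "(a + \<xi>) * real n \<ge> a * real n" using pos by (intro mult_right_mono) auto
  have "pulls \<pi> i n \<omega> > 0" using big axn n by linarith
  then obtain s where s: "Suc s \<le> n" "\<pi> (Suc s) \<omega> = i" "pulls \<pi> i n \<omega> = Suc (pulls \<pi> i s \<omega>)"
    by (rule pulls_last_play)
  have i: "i \<in> {1, 2}" and j: "j \<in> {1, 2}" using ij by auto
  let ?Ni = "pulls \<pi> i s \<omega>" and ?Nj = "pulls \<pi> j s \<omega>"
  define x y where "x = real ?Nj / real n" and "y = real ?Ni / real n"
  have n0: "real n > 0" and lnn: "ln (real n) > 0" using n by auto
  have L0: "L > 0" using n0 lnn by (simp add: L_def)
  have L2: "L\<^sup>2 = ln (real n) / real n" using n0 lnn by (simp add: L_def)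
  \<comment> \<open>The \<open>+ 1\<close> in the claimed bound pays for the last play itself, so
    the count before it is still at least \<open>(a + \<xi>) * n\<close>.\<close>
  have Ni_ge: "real ?Ni \<ge> (a + \<xi>) * real n" using big s by linarith
  have Ns: "?Ni + ?Nj = s" by (rule pulls_add[OF \<omega> ij])
  \<comment> \<open>The last play comes late. Hence \<open>ln s\<close> is close to
    \<open>ln n\<close>, both arms have been played by time \<open>s\<close>, and
    \<open>Suc s \<ge> 3\<close> is governed by the index rule.\<close>
  have s_ge: "real s \<ge> a * real n" using Ns Ni_ge axn by linarith
  then have s2: "s \<ge> 2" using n by linarith
  have Nj0: "?Nj > 0" by (rule pulls_pos[OF \<omega> j s2])
  have Ni0: "?Ni > 0" by (rule pulls_pos[OF \<omega> i s2])
  have x0: "x > 0" using Nj0 n0 by (simp add: x_def)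
  have ya: "a + \<xi> \<le> y" using Ni_ge n0 by (simp add: y_def field_simps)
  have y0: "y > 0" using Ni0 n0 by (simp add: y_def)
  have "real ?Nj \<le> (1 - a - \<xi>) * real n" using Ns Ni_ge s(1) by (simp add: algebra_simps)
  then have x1: "x \<le> 1 - a - \<xi>" using n0 by (simp add: x_def field_simps)
  have Nx: "real ?Nj = x * real n" and Ny: "real ?Ni = y * real n"
    using n0 by (auto simp: x_def y_def)
  have nL: "sqrt (real n * ln (real n)) = real n * L"
    using n0 lnn by (intro real_sqrt_unique) (auto simp: L2 power_mult_distrib power2_eq_square[of "real n"] less_imp_le[OF L0])
  have kL: "sqrt (real k * ln (real n)) = real n * L * sqrt (real k / real n)" for k
    using n0 unfolding nL[symmetric] real_sqrt_mult[symmetric] by simp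
  have mean: "sample_mean X \<pi> k s \<omega> = arm_mean P k + noise P X k (pulls \<pi> k s \<omega>) \<omega> / real (pulls \<pi> k s \<omega>)"
    if "pulls \<pi> k s \<omega> > 0" for k
    using that unfolding sample_mean_def sum_rewards[where P = P] by (simp add: add_divide_distrib)
  have "\<bar>noise P X i ?Ni \<omega>\<bar> \<le> \<eta> * sqrt (real n * ln (real n))"
    using conc i Ni0 Ns s(1) by (auto simp: concentrated_def)
  then have ci: "noise P X i ?Ni \<omega> \<le> \<eta> * (real n * L)" unfolding nL by linarith
  have "\<bar>noise P X j ?Nj \<omega>\<bar> \<le> sqrt (real ?Nj * ln (real n))"
    "\<bar>noise P X j ?Nj \<omega>\<bar> \<le> \<eta> * sqrt (real n * ln (real n))"
    using conc j Nj0 Ns s(1) by (auto simp: concentrated_def)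
  then have cj: "noise P X j ?Nj \<omega> \<ge> - (real n * L * sqrt x)"
      "noise P X j ?Nj \<omega> \<ge> - (\<eta> * (real n * L))"
    unfolding nL kL[of ?Nj] x_def[symmetric] by linarith+
  \<comment> \<open>The bonus of \<open>i\<close> is bounded from above with \<open>ln n\<close>,
    that of \<open>j\<close> from below with \<open>ln (a * n)\<close>.\<close>
  have lns: "ln (real s) \<le> ln (real n)" "ln (a * real n) \<le> ln (real s)"
    using s s2 s_ge n by (auto simp: ln_mono)
  have "ucb_index \<rho> X \<pi> i s \<omega> \<le> arm_mean P i + L * (sqrt \<rho> / sqrt y + \<eta> / y)"
  proof -
    have "noise P X i ?Ni \<omega> / real ?Ni \<le> \<eta> * (real n * L) / real ?Ni"
      using ci by (intro divide_right_mono) auto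
    also have "\<dots> = L * (\<eta> / y)" using n0 y0 by (simp add: Ny)
    finally have 1: "noise P X i ?Ni \<omega> / real ?Ni \<le> L * (\<eta> / y)" .
    have "\<rho> * ln (real s) / real ?Ni \<le> \<rho> * ln (real n) / real ?Ni"
      using lns pos by (intro divide_right_mono mult_left_mono) auto
    then have "sqrt (\<rho> * ln (real s) / real ?Ni) \<le> sqrt (\<rho> * ln (real n) / real ?Ni)"
      by simp
    also have "\<dots> = L * (sqrt \<rho> / sqrt y)"
      by (simp add: Ny L_def real_sqrt_mult real_sqrt_divide mult_ac)
    finally show ?thesis using 1 unfolding ucb_index_def mean[OF Ni0] by (simp add: algebra_simps)
  qed
  moreover have "ucb_index \<rho> X \<pi> j s \<omega> \<ge> arm_mean P j
      + L * (sqrt (\<rho> * (ln (a * real n) / ln (real n))) / sqrt x - min (1 / sqrt x) (\<eta> / x))"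
  proof -
    have "- (real n * L * sqrt x) / real ?Nj \<le> noise P X j ?Nj \<omega> / real ?Nj"
      using cj by (intro divide_right_mono) auto
    moreover have "- (real n * L * sqrt x) / real ?Nj = - (L * (1 / sqrt x))"
      using n0 x0 real_sqrt_mult_self[of x] unfolding Nx by (simp add: field_simps)
    ultimately have 1: "- (L * (1 / sqrt x)) \<le> noise P X j ?Nj \<omega> / real ?Nj" by simp
    have "- (\<eta> * (real n * L)) / real ?Nj \<le> noise P X j ?Nj \<omega> / real ?Nj"
      using cj by (intro divide_right_mono) auto
    moreover have "- (\<eta> * (real n * L)) / real ?Nj = - (L * (\<eta> / x))"
      using n0 x0 by (simp add: Nx)
    ultimately have 2: "- (L * (\<eta> / x)) \<le> noise P X j ?Nj \<omega> / real ?Nj" by simp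
    have 3: "- (L * min (1 / sqrt x) (\<eta> / x)) \<le> noise P X j ?Nj \<omega> / real ?Nj"
      using 1 2 by (simp add: min_def)
    have "\<rho> * ln (a * real n) / real ?Nj \<le> \<rho> * ln (real s) / real ?Nj"
      using lns pos by (intro divide_right_mono mult_left_mono) auto
    then have "sqrt (\<rho> * ln (a * real n) / real ?Nj) \<le> sqrt (\<rho> * ln (real s) / real ?Nj)"
      by simp
    moreover have "\<rho> * ln (a * real n) / real ?Nj
        = ln (real n) / real n * (\<rho> * (ln (a * real n) / ln (real n)) / x)"
      using n0 x0 lnn by (simp add: Nx field_simps)
    ultimately have "L * (sqrt (\<rho> * (ln (a * real n) / ln (real n))) / sqrt x)
        \<le> sqrt (\<rho> * ln (real s) / real ?Nj)"
      unfolding L_def by (simp only: real_sqrt_mult real_sqrt_divide)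
    then show ?thesis using 3 unfolding ucb_index_def mean[OF Nj0] by (simp add: algebra_simps)
  qed
  moreover have "ucb_index \<rho> X \<pi> j s \<omega> \<le> ucb_index \<rho> X \<pi> i s \<omega>"
    using ucb_play[of "Suc s" \<omega>] \<omega> s(2) s2 j by (auto simp: is_arg_max_linorder)
  moreover have "L * ((arm_mean P i - arm_mean P j) / L + sqrt \<rho> / sqrt y + \<eta> / y)
      < L * (sqrt (\<rho> * (ln (a * real n) / ln (real n))) / sqrt x - min (1 / sqrt x) (\<eta> / x))"
    using separated[OF x0 x1 ya] L0 by (simp only: mult_less_cancel_left_pos)
  ultimately show False using L0 by (simp add: distrib_left)
qed

text \<open>As the counts add up to \<open>n\<close>, the two upper bounds confine the fraction of
  plays of \<open>w\<close> to within \<open>2 * \<xi>\<close> of \<open>p\<close>, the summands 1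
  being absorbed by \<open>\<xi> * n\<close>. The scaled gap is at most \<open>s + 1\<close>; of
  \<open>3 * \<eta>\<close>, two parts are noise and one is the error of the gap.\<close>

lemma regret_close:
  fixes n :: nat and s \<eta> \<xi> p :: real
  defines "L \<equiv> sqrt (ln (real n) / real n)"
  assumes \<omega>: "\<omega> \<in> space M" and wb: "{w, b} = {1, 2}" "arm_mean P w \<le> arm_mean P b"
    and conc: "concentrated P X \<eta> n \<omega>" and n: "n \<ge> 2" "1 \<le> \<xi> * real n"
    and gap: "\<bar>gap P / L - s\<bar> \<le> \<eta>" and s: "s \<ge> 0" and \<eta>: "\<eta> \<le> 1" and p: "0 \<le> p" "p \<le> 1"
    and w: "real (pulls \<pi> w n \<omega>) \<le> (p + \<xi>) * real n + 1"
    and b: "real (pulls \<pi> b n \<omega>) \<le> (1 - p + \<xi>) * real n + 1"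
  shows "\<bar>regret P X \<pi> n \<omega> / sqrt (real n * ln (real n)) - s * p\<bar> \<le> (s + 1) * (2 * \<xi>) + 3 * \<eta>"
proof -
  let ?Q = "sqrt (real n * ln (real n))" and ?q = "real (pulls \<pi> w n \<omega>) / real n"
  define g where "g = gap P / L"
  have n0: "real n > 0" and lnn: "ln (real n) > 0" using n by auto
  have L0: "L > 0" using n0 lnn by (simp add: L_def)
  have \<xi>0: "\<xi> > 0" using n n0 by (smt (verit) mult_nonpos_nonneg)
  have nL: "?Q = real n * L"
    using n0 lnn L0 by (intro real_sqrt_unique) (auto simp: L_def power_mult_distrib power2_eq_square[of "real n"])
  have Q0: "?Q > 0" using n0 L0 unfolding nL by simp
  have "\<bar>noise P X i (pulls \<pi> i n \<omega>) \<omega>\<bar> \<le> \<eta> * ?Q" if "i \<in> {1, 2}" for i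
    using conc that pulls_pos[OF \<omega> that n(1)] pulls_le[of \<pi> i n \<omega>]
    by (auto simp: concentrated_def)
  moreover have "w \<in> {1, 2}" "b \<in> {1, 2}" using wb by auto
  ultimately have noise: "\<bar>noise P X w (pulls \<pi> w n \<omega>) \<omega>\<bar> \<le> \<eta> * ?Q"
      "\<bar>noise P X b (pulls \<pi> b n \<omega>) \<omega>\<bar> \<le> \<eta> * ?Q"
    by blast+
  let ?z = "- noise P X w (pulls \<pi> w n \<omega>) \<omega> - noise P X b (pulls \<pi> b n \<omega>) \<omega>"
  have "regret P X \<pi> n \<omega> / ?Q = gap P * real (pulls \<pi> w n \<omega>) / ?Q + ?z / ?Q"
    unfolding regret_decomposition[OF \<omega> wb] by (simp add: diff_divide_distrib add_divide_distrib)
  moreover have "gap P * real (pulls \<pi> w n \<omega>) / ?Q = g * ?q"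
    unfolding nL g_def using L0 by simp
  moreover have "\<bar>?z / ?Q\<bar> \<le> 2 * \<eta>"
  proof -
    have "\<bar>?z\<bar> \<le> 2 * \<eta> * ?Q" using noise by linarith
    then show ?thesis using Q0 by (simp only: abs_divide abs_of_pos pos_divide_le_eq)
  qed
  moreover have "\<bar>g * ?q - s * p\<bar> \<le> (s + 1) * (2 * \<xi>) + \<eta>"
  proof -
    have "real (pulls \<pi> w n \<omega>) + real (pulls \<pi> b n \<omega>) = real n"
      using pulls_add[OF \<omega> wb(1), of n] by linarith
    then have "real (pulls \<pi> w n \<omega>) \<le> (p + 2 * \<xi>) * real n" "(p - 2 * \<xi>) * real n \<le> real (pulls \<pi> w n \<omega>)"
      using w b n by (simp_all add: algebra_simps)
    then have q: "\<bar>?q - p\<bar> \<le> 2 * \<xi>" using n0 by (simp add: abs_le_iff field_simps)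
    have "g * ?q - s * p = g * (?q - p) + (g - s) * p" by (simp add: algebra_simps)
    then have "\<bar>g * ?q - s * p\<bar> \<le> \<bar>g * (?q - p)\<bar> + \<bar>(g - s) * p\<bar>"
      by (simp only: abs_triangle_ineq)
    then have "\<bar>g * ?q - s * p\<bar> \<le> \<bar>g\<bar> * \<bar>?q - p\<bar> + \<bar>g - s\<bar> * p"
      using p by (simp only: abs_mult abs_of_nonneg)
    moreover have "\<bar>g\<bar> * \<bar>?q - p\<bar> \<le> (s + 1) * (2 * \<xi>)"
      using gap s \<eta> q by (intro mult_mono) (auto simp: g_def)
    moreover have "\<bar>g - s\<bar> * p \<le> \<eta> * 1"
      using gap p by (intro mult_mono) (auto simp: g_def)
    ultimately show ?thesis by linarith
  qed
  ultimately show ?thesis by linarith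
qed

end

section \<open>Weak convergence of the regret\<close>

theorem theorem4:
  fixes \<rho> \<theta> :: real
    and M :: "nat \<Rightarrow> 'a measure"
    and P :: "nat \<Rightarrow> nat \<Rightarrow> real measure"
    and X :: "nat \<Rightarrow> nat \<Rightarrow> nat \<Rightarrow> 'a \<Rightarrow> real"
    and S :: "nat \<Rightarrow> 'u measure"
    and U :: "nat \<Rightarrow> 'a \<Rightarrow> 'u"
    and \<pi> :: "nat \<Rightarrow> nat \<Rightarrow> 'a \<Rightarrow> nat"
  assumes "\<rho> > 1" and "\<theta> \<ge> 0"
    and "\<And>n. canonical_ucb (M n) (P n) (X n) (S n) (U n) \<rho> (\<pi> n)"
    and "(\<lambda>n. gap (P n) * sqrt (real n / ln (real n))) \<longlonglongrightarrow> sqrt \<theta>"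
  shows "(\<exists>!l. l \<in> {0<..<1} \<and> lambda_eq \<rho> \<theta> l) \<and>
    weak_conv_m
      (\<lambda>n. distr (M n) borel (\<lambda>\<omega>. regret (P n) (X n) (\<pi> n) n \<omega> / sqrt (real n * ln (real n))))
      (return borel (h_fun \<rho> \<theta>))"
proof
  have \<rho>0: "\<rho> > 0" using assms(1) by simp
  show unique: "\<exists>!l. l \<in> {0<..<1} \<and> lambda_eq \<rho> \<theta> l"
    by (rule lambda_unique[OF \<rho>0 assms(2)])
  define l where "l = lambda_star \<rho> \<theta>"
  define s where "s = sqrt \<theta>"
  have l: "0 < l" "l < 1" "lambda_eq \<rho> \<theta> l"
    using theI'[OF unique] unfolding lambda_star_def[symmetric] l_def[symmetric] by auto
  have s0: "s \<ge> 0" using assms(2) by (simp add: s_def)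
  have "sqrt \<rho> * (1 / sqrt (1 - l) - 1 / sqrt l) = sqrt \<rho> * sqrt (\<theta> / \<rho>)"
    using l(3) by (simp add: lambda_eq_def)
  also have "\<dots> = s" using \<rho>0 by (simp add: s_def real_sqrt_divide)
  \<comment> \<open>The defining equation read from both sides: the better arm has limiting fraction
    \<open>l\<close> and scaled advantage \<open>s\<close>, the inferior arm \<open>1 - l\<close>
    and \<open>- s\<close>.\<close>
  finally have balance: "s + sqrt \<rho> / sqrt l = sqrt \<rho> / sqrt (1 - l)"
    "- s + sqrt \<rho> / sqrt (1 - l) = sqrt \<rho> / sqrt (1 - (1 - l))"
    by (simp_all add: algebra_simps)
  define L where "L n = sqrt (ln (real n) / real n)" for n
  have gap_lim: "(\<lambda>n. gap (P n) / L n) \<longlonglongrightarrow> s"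
    using assms(4) by (simp add: L_def s_def real_sqrt_divide)
  define w where "w n = (if arm_mean (P n) 1 \<le> arm_mean (P n) 2 then 1 else 2::nat)" for n
  define b where "b n = (if arm_mean (P n) 1 \<le> arm_mean (P n) 2 then 2 else 1::nat)" for n
  have wb: "{w n, b n} = {1, 2}" "{b n, w n} = {1, 2}" "arm_mean (P n) (w n) \<le> arm_mean (P n) (b n)"
    and gap_wb: "gap (P n) = arm_mean (P n) (b n) - arm_mean (P n) (w n)" for n
    by (auto simp: w_def b_def gap_def)
  show "weak_conv_m
      (\<lambda>n. distr (M n) borel (\<lambda>\<omega>. regret (P n) (X n) (\<pi> n) n \<omega> / sqrt (real n * ln (real n))))
      (return borel (h_fun \<rho> \<theta>))"
  proof (rule weak_conv_m_return)
    show "prob_space (M n)" for n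
      using assms(3)[of n] unfolding canonical_ucb_def two_armed_bandit_def by blast
    show "(\<lambda>\<omega>. regret (P n) (X n) (\<pi> n) n \<omega> / sqrt (real n * ln (real n))) \<in> borel_measurable (M n)" for n
      using canonical_ucb.regret_measurable[OF assms(3)] by (rule borel_measurable_divide) simp
    fix e :: real assume e: "e > 0"
    \<comment> \<open>The inner minimum keeps both perturbed fractions below 1; the last term limits
      the error from the counts to \<open>e / 2\<close>. With \<open>\<eta> < e / 6\<close>, the
      remaining \<open>3 * \<eta>\<close> fits into the other half.\<close>
    define \<xi> where "\<xi> = min (min (l / 2) ((1 - l) / 2)) (e / (4 * (s + 1)))"
    have \<xi>_le: "\<xi> \<le> l / 2" "\<xi> \<le> (1 - l) / 2"
      by (simp_all only: \<xi>_def min_le_iff_disj order_refl simp_thms)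
    have \<xi>: "\<xi> > 0" "l + \<xi> < 1" "1 - l + \<xi> < 1"
    proof -
      show "\<xi> > 0" using l e s0 by (simp add: \<xi>_def)
      show "l + \<xi> < 1" using \<xi>_le(2) l(2) by (simp add: field_simps)
      show "1 - l + \<xi> < 1" using \<xi>_le(1) l(1) by (simp add: field_simps)
    qed
    have "\<xi> \<le> e / (4 * (s + 1))" by (simp add: \<xi>_def)
    then have \<xi>e: "(s + 1) * (2 * \<xi>) \<le> e / 2" using s0 by (simp add: field_simps)
    have "\<forall>\<^sub>F \<eta> in at_right 0. \<eta> < min 1 (e / 6)"
      using e by (intro order_tendstoD(2)[OF tendsto_ident_at]) auto
    from eventually_happens[OF eventually_conj[OF eventually_conj[OF
          index_separation[OF assms(1) l(1) \<xi>(1,2) balance(1)]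
          index_separation[OF assms(1) _ \<xi>(1,3) balance(2)]]
          eventually_conj[OF this eventually_at_right_less]]]
    obtain \<eta> where \<eta>: "0 < \<eta>" "\<eta> < 1" "\<eta> < e / 6"
      and sepb: "\<And>x y d r. 0 < x \<Longrightarrow> x \<le> 1 - l - \<xi> \<Longrightarrow> l + \<xi> \<le> y \<Longrightarrow> \<bar>d - s\<bar> \<le> \<eta> \<Longrightarrow> 1 - \<eta> \<le> r \<Longrightarrow>
          d + sqrt \<rho> / sqrt y + \<eta> / y < sqrt (\<rho> * r) / sqrt x - min (1 / sqrt x) (\<eta> / x)"
      and sepw: "\<And>x y d r. 0 < x \<Longrightarrow> x \<le> 1 - (1 - l) - \<xi> \<Longrightarrow> 1 - l + \<xi> \<le> y \<Longrightarrow> \<bar>d - - s\<bar> \<le> \<eta> \<Longrightarrow>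
          1 - \<eta> \<le> r \<Longrightarrow>
          d + sqrt \<rho> / sqrt y + \<eta> / y < sqrt (\<rho> * r) / sqrt x - min (1 / sqrt x) (\<eta> / x)"
      using l by (auto simp: trivial_limit_at_right_real)
    have log_ratio: "\<forall>\<^sub>F n in sequentially. 1 - \<eta> \<le> ln (a * real n) / ln (real n)" if "a > 0" for a
    proof -
      have "(\<lambda>n. ln (a * real n) / ln (real n)) \<longlonglongrightarrow> 1" using that by real_asymp
      from order_tendstoD(1)[OF this, of "1 - \<eta>"] \<eta> show ?thesis
        by (auto elim: eventually_mono)
    qed
    have large: "\<forall>\<^sub>F n in sequentially. c \<le> a * real n" if "a > 0" for a c
      using that by real_asymp
    have gap_close: "\<forall>\<^sub>F n in sequentially. \<bar>gap (P n) / L n - s\<bar> \<le> \<eta>"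
      using tendstoD[OF gap_lim \<eta>(1)] by (auto simp: dist_real_def elim: eventually_mono)
    have l': "1 - l > 0" using l by simp
    have "\<eta>\<^sup>2 > 0" using \<eta> by simp
    \<comment> \<open>The right-hand side depends on \<open>n\<close> but not on the instance, so it
      does not matter how the reward laws vary with \<open>n\<close>.\<close>
    have bound: "\<forall>\<^sub>F n in sequentially.
        measure (M n) {\<omega> \<in> space (M n).
          \<bar>regret (P n) (X n) (\<pi> n) n \<omega> / sqrt (real n * ln (real n)) - h_fun \<rho> \<theta>\<bar> > e}
        \<le> 8 / real n + 32 / \<eta>\<^sup>2 * real n powr (- (\<eta>\<^sup>2 / 2))"
      using gap_close log_ratio[OF l(1)] log_ratio[OF l'] large[OF l(1), of 2] large[OF l', of 2]
        large[OF \<xi>(1), of 1] large[OF \<open>\<eta>\<^sup>2 > 0\<close>, of 8] eventually_ge_at_top[of 2]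
    proof eventually_elim
      fix n assume gapn: "\<bar>gap (P n) / L n - s\<bar> \<le> \<eta>"
        and r: "1 - \<eta> \<le> ln (l * real n) / ln (real n)" "1 - \<eta> \<le> ln ((1 - l) * real n) / ln (real n)"
        and n: "2 \<le> l * real n" "2 \<le> (1 - l) * real n" "1 \<le> \<xi> * real n" "8 \<le> \<eta>\<^sup>2 * real n" "n \<ge> 2"
      interpret canonical_ucb "M n" "P n" "X n" "S n" "U n" \<rho> "\<pi> n" by (rule assms(3))
      have dw: "\<bar>(arm_mean (P n) (w n) - arm_mean (P n) (b n)) / L n - - s\<bar> \<le> \<eta>"
        and db: "\<bar>(arm_mean (P n) (b n) - arm_mean (P n) (w n)) / L n - s\<bar> \<le> \<eta>"
        using gapn unfolding gap_wb by (simp_all add: diff_divide_distrib abs_le_iff)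
      have close: "\<bar>regret (P n) (X n) (\<pi> n) n \<omega> / sqrt (real n * ln (real n)) - h_fun \<rho> \<theta>\<bar> \<le> e"
        if \<omega>: "\<omega> \<in> space (M n)" and conc: "concentrated (P n) (X n) \<eta> n \<omega>" for \<omega>
      proof -
        \<comment> \<open>Each arm is bounded from above only; together the two bounds also act as
          lower bounds, in \<open>regret_close\<close>.\<close>
        have Nw: "real (pulls (\<pi> n) (w n) n \<omega>) \<le> (1 - l + \<xi>) * real n + 1"
          by (rule pulls_upper_bound[OF \<omega> wb(1) conc \<rho>0 l' \<xi>(1) \<eta>(1) n(2) n(5)])
            (rule sepw[OF _ _ _ dw r(2), unfolded L_def])
        have Nb: "real (pulls (\<pi> n) (b n) n \<omega>) \<le> (l + \<xi>) * real n + 1"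
          by (rule pulls_upper_bound[OF \<omega> wb(2) conc \<rho>0 l(1) \<xi>(1) \<eta>(1) n(1) n(5)])
            (rule sepb[OF _ _ _ db r(1), unfolded L_def])
        have "\<bar>regret (P n) (X n) (\<pi> n) n \<omega> / sqrt (real n * ln (real n)) - s * (1 - l)\<bar>
            \<le> (s + 1) * (2 * \<xi>) + 3 * \<eta>"
          using gapn Nb l s0 \<eta> unfolding L_def
          by (intro regret_close[OF \<omega> wb(1,3) conc n(5,3) _ _ _ _ _ Nw]) auto
        also have "\<dots> \<le> e" using \<xi>e \<eta> by linarith
        finally show ?thesis by (simp add: h_fun_def s_def l_def)
      qed
      have "prob {\<omega> \<in> space (M n).
          \<bar>regret (P n) (X n) (\<pi> n) n \<omega> / sqrt (real n * ln (real n)) - h_fun \<rho> \<theta>\<bar> > e}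
          \<le> prob {\<omega> \<in> space (M n). \<not> concentrated (P n) (X n) \<eta> n \<omega>}"
      proof (rule finite_measure_mono)
        have "{\<omega> \<in> space (M n). \<not> concentrated (P n) (X n) \<eta> n \<omega>}
            = space (M n) - {\<omega> \<in> space (M n). concentrated (P n) (X n) \<eta> n \<omega>}" by auto
        then show "{\<omega> \<in> space (M n). \<not> concentrated (P n) (X n) \<eta> n \<omega>} \<in> events"
          using concentrated_event by auto
      qed (use close in force)
      also have "\<dots> \<le> 8 / real n + 32 / \<eta>\<^sup>2 * real n powr (- (\<eta>\<^sup>2 / 2))"
        by (rule prob_not_concentrated[OF \<eta>(1) n(4)])
      finally show "prob {\<omega> \<in> space (M n).
          \<bar>regret (P n) (X n) (\<pi> n) n \<omega> / sqrt (real n * ln (real n)) - h_fun \<rho> \<theta>\<bar> > e}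
          \<le> 8 / real n + 32 / \<eta>\<^sup>2 * real n powr (- (\<eta>\<^sup>2 / 2))" .
    qed
    have "(\<lambda>n. 8 / real n + C * real n powr (- c)) \<longlonglongrightarrow> 0" if "c > 0" for C c :: real
    proof -
      have "(\<lambda>n. real n powr (- c)) \<longlonglongrightarrow> 0"
        using that by real_asymp
      from tendsto_add[OF lim_const_over_n[of 8] tendsto_mult_right_zero[OF this]]
      show ?thesis by simp
    qed
    from this[of "\<eta>\<^sup>2 / 2" "32 / \<eta>\<^sup>2"] \<open>\<eta>\<^sup>2 > 0\<close>
    have "(\<lambda>n. 8 / real n + 32 / \<eta>\<^sup>2 * real n powr (- (\<eta>\<^sup>2 / 2))) \<longlonglongrightarrow> 0"
      by simp
    from tendsto_sandwich[OF _ bound tendsto_const this]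
    show "(\<lambda>n. measure (M n) {\<omega> \<in> space (M n).
          \<bar>regret (P n) (X n) (\<pi> n) n \<omega> / sqrt (real n * ln (real n)) - h_fun \<rho> \<theta>\<bar> > e}) \<longlonglongrightarrow> 0"
      by simp
  qed
qed

end
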